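(* Let $\mathcal{X}$ be a measurable subset of a Euclidean space with Lebesgue measure $|\mathcal{X}|\in(0,\infty)$, let $C>1/|\mathcal{X}|$ be a constant, and let $S$ be a probability distribution on $\mathcal{X}$ with density $P_S$. Let $\mathcal{Z}$ be the family of probability distributions $Z$ on $\mathcal{X}$ with density satisfying $0\le P_Z(x)\le C$ for all $x\in\mathcal{X}$. Let $\bar S$ be the uniform distribution on $\mathcal{X}$, and let $\mathcal{S}^-$ be the family of all non-uniform re-weightings of $S$, namely the probability distributions $S'$ on $\mathcal{X}$ with density $P_{S'}(x)=h(x)P_S(x)$ for some measurable $h$ with $h(x)>0$ for all $x\in\mathcal{X}$ and $\int_{\mathcal{X}}P_{S'}(x)\,dx=1$, such that there exists a measurable $\mathcal{J}\subset\mathcal{X}$ with $\int_{\mathcal{J}}P_{S'}(x)\,dx<|\mathcal{J}|/|\mathcal{X}|$. Then for every $S'\in\mathcal{S}^-$, $$\sup_{Z\in\mathcal{Z}}d_1(Z,S')>\sup_{Z\in\mathcal{Z}}d_1(Z,\bar S).$$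
   Context: For a measurable set $\mathcal{J}$, $|\mathcal{J}|$ denotes its Lebesgue measure. All distributions are given by densities with respect to Lebesgue measure on $\mathcal{X}$; the uniform distribution has $P_{\bar S}(x)=1/|\mathcal{X}|$ for almost every $x$. For two distributions $S_1,S_2$ on $\mathcal{X}$, the variation divergence is $$d_1(S_1,S_2)=2\sup_{\mathcal{J}\subset\mathcal{X}}\left|\int_{\mathcal{J}}\big(P_{S_1}(x)-P_{S_2}(x)\big)\,dx\right|,$$ where the supremum is over measurable subsets $\mathcal{J}$ of $\mathcal{X}$. *)

theory Defs
  imports "HOL-Analysis.Analysis"
begin

text \<open>
  A distribution on \<open>X\<close> is given by a real-valued density with respect to Lebesgue measure; only
  the values of the density on \<open>X\<close> matter. Measurability is Lebesgue measurability throughout.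
\<close>

definition prob_density_on :: "'a::euclidean_space set \<Rightarrow> ('a \<Rightarrow> real) \<Rightarrow> bool" where
  "prob_density_on X P \<longleftrightarrow>
     set_integrable lebesgue X P \<and> (\<forall>x\<in>X. 0 \<le> P x) \<and> (LINT x:X|lebesgue. P x) = 1"

definition uniform_density_on :: "'a::euclidean_space set \<Rightarrow> ('a \<Rightarrow> real) \<Rightarrow> bool" where
  "uniform_density_on X P \<longleftrightarrow>
     prob_density_on X P \<and> (AE x\<in>X in lebesgue. P x = 1 / measure lebesgue X)"

definition variation_divergence ::
    "'a::euclidean_space set \<Rightarrow> ('a \<Rightarrow> real) \<Rightarrow> ('a \<Rightarrow> real) \<Rightarrow> real" where
  "variation_divergence X P Q =
     2 * (SUP J\<in>{J \<in> sets lebesgue. J \<subseteq> X}. \<bar>LINT x:J|lebesgue. (P x - Q x)\<bar>)"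

definition bounded_densities :: "'a::euclidean_space set \<Rightarrow> real \<Rightarrow> ('a \<Rightarrow> real) set" where
  "bounded_densities X C = {P. prob_density_on X P \<and> (\<forall>x\<in>X. 0 \<le> P x \<and> P x \<le> C)}"

definition nonuniform_reweightings ::
    "'a::euclidean_space set \<Rightarrow> ('a \<Rightarrow> real) \<Rightarrow> ('a \<Rightarrow> real) set" where
  "nonuniform_reweightings X P =
     {Q. prob_density_on X Q \<and>
         (\<exists>h. set_borel_measurable lebesgue X h \<and> (\<forall>x\<in>X. 0 < h x) \<and> (\<forall>x\<in>X. Q x = h x * P x)) \<and>
         (\<exists>J\<in>sets lebesgue. J \<subseteq> X \<and>
            (LINT x:J|lebesgue. Q x) < measure lebesgue J / measure lebesgue X)}"

text \<open>
  The suprema are taken in the conditionally complete type of reals. The following facts show that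
  they are suprema of nonempty bounded sets, hence never take an unspecified value.
\<close>

lemma integral_diff_le_1:
  assumes "prob_density_on X P" "prob_density_on X Q" "J \<in> sets lebesgue" "J \<subseteq> X"
  shows "\<bar>LINT x:J|lebesgue. (P x - Q x)\<bar> \<le> 1"
proof -
  have *: "set_integrable lebesgue J R \<and> 0 \<le> (LINT x:J|lebesgue. R x) \<and> (LINT x:J|lebesgue. R x) \<le> 1"
    if R: "prob_density_on X R" for R
  proof -
    have int: "set_integrable lebesgue X R" and nn: "\<And>x. x \<in> X \<Longrightarrow> 0 \<le> R x"
      and one: "(LINT x:X|lebesgue. R x) = 1"
      using R by (auto simp: prob_density_on_def)
    have intJ: "set_integrable lebesgue J R"
      using set_integrable_subset[OF int assms(3,4)] .
    have "0 \<le> (LINT x:J|lebesgue. R x)"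
      unfolding set_lebesgue_integral_def
      using nn assms(4) by (intro integral_nonneg_AE) (auto simp: indicator_def)
    moreover have "(LINT x:J|lebesgue. R x) \<le> (LINT x:X|lebesgue. R x)"
      unfolding set_lebesgue_integral_def
      using int intJ nn assms(4)
      by (intro integral_mono) (auto simp: indicator_def set_integrable_def)
    ultimately show ?thesis using intJ one by simp
  qed
  show ?thesis using *[OF assms(1)] *[OF assms(2)] by (auto simp: set_integral_diff)
qed

lemma bdd_above_variation_divergence:
  assumes "prob_density_on X P" "prob_density_on X Q"
  shows "bdd_above ((\<lambda>J. \<bar>LINT x:J|lebesgue. (P x - Q x)\<bar>) ` {J \<in> sets lebesgue. J \<subseteq> X})"
  using integral_diff_le_1[OF assms] by (intro bdd_aboveI2[where M = 1]) auto

lemma variation_divergence_le_2: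
  assumes "prob_density_on X P" "prob_density_on X Q"
  shows "variation_divergence X P Q \<le> 2"
proof -
  have "(SUP J\<in>{J \<in> sets lebesgue. J \<subseteq> X}. \<bar>LINT x:J|lebesgue. (P x - Q x)\<bar>) \<le> 1"
    using integral_diff_le_1[OF assms] by (intro cSUP_least) auto
  then show ?thesis by (simp add: variation_divergence_def)
qed

lemma bdd_above_variation_divergence_family:
  assumes "prob_density_on X Q"
  shows "bdd_above ((\<lambda>P. variation_divergence X P Q) ` bounded_densities X C)"
  using variation_divergence_le_2[OF _ assms]
  by (intro bdd_aboveI2[where M = 2]) (auto simp: bounded_densities_def)

lemma bounded_densities_nonempty:
  assumes "X \<in> lmeasurable" "0 < measure lebesgue X" "C > 1 / measure lebesgue X"
  shows "(\<lambda>x. 1 / measure lebesgue X) \<in> bounded_densities X C"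
proof -
  have fin: "emeasure lebesgue X < \<infinity>" and X: "X \<in> sets lebesgue"
    using assms(1) by (auto simp: fmeasurable_def)
  have "set_integrable lebesgue X (\<lambda>x. 1 / measure lebesgue X)"
    unfolding set_integrable_def using assms(1) 
    by (intro integrable_scaleR_left integrable_real_indicator X fin)
  moreover have "(LINT x:X|lebesgue. 1 / measure lebesgue X) = 1"
    unfolding set_lebesgue_integral_def using assms(2) X by simp
  ultimately show ?thesis
    using assms(2,3) by (auto simp: bounded_densities_def prob_density_on_def)
qed

end

theory Submission
  imports Defs
begin

text \<open>
  Write \<open>V = |X|\<close>. A density bounded by \<open>C\<close> gives \<open>J\<close> mass at most \<open>min 1 (C |J|)\<close>, and the deviation
  from the uniform distribution on \<open>J\<close> and on \<open>X - J\<close> differ only in sign, so no bounded density is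
  further than \<open>2 (1 - 1 / (C V))\<close> from uniform. If \<open>Q\<close> is not uniform, Lebesgue measure being
  atomless yields a set \<open>J\<close> of measure \<open>1 / C\<close> with \<open>Q(J) < 1 / (C V)\<close>; the density \<open>C\<close> on \<open>J\<close> then is
  at distance at least \<open>2 (1 - Q(J)) > 2 (1 - 1 / (C V))\<close> from \<open>Q\<close>.
\<close>

section \<open>Sets of prescribed Lebesgue measure\<close>

lemma lmeasurable_Un_Int_ball:
  fixes A B :: "'a::euclidean_space set"
  assumes "A \<in> lmeasurable" "B \<in> lmeasurable"
  shows "A \<union> (B \<inter> ball 0 r) \<in> lmeasurable"
  by (intro fmeasurable.Un assms fmeasurable_Int_fmeasurable) auto

text \<open>Enlarging the radius adds at most the shell between the two balls, so increments of this
  function are dominated by those of the ball volume. That volume is a monomial in the radius only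
  for \<open>0 \<le> r\<close>, hence the domain \<open>{0..}\<close>.\<close>

lemma continuous_on_measure_Un_Int_ball:
  fixes A B :: "'a::euclidean_space set"
  assumes A: "A \<in> lmeasurable" and B: "B \<in> lmeasurable"
  shows "continuous_on {0..} (\<lambda>r. measure lebesgue (A \<union> (B \<inter> ball 0 r)))" (is "continuous_on _ ?g")
proof -
  define h where "h r = measure lebesgue (ball (0::'a) r)" for r
  have h_eq: "h r = unit_ball_vol (real DIM('a)) * r ^ DIM('a)" if "0 \<le> r" for r
    using content_ball[OF that, of "0::'a"] by (simp add: h_def)
  have h_cont: "continuous_on {0..} h"
    by (subst continuous_on_cong[OF refl h_eq]) (auto intro!: continuous_intros)
  have mono: "0 \<le> ?g s - ?g r \<and> ?g s - ?g r \<le> h s - h r" if "r \<le> s" for r s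
  proof
    have sub: "ball (0::'a) r \<subseteq> ball 0 s" using that by auto
    have "?g r \<le> ?g s"
      using sub lmeasurable_Un_Int_ball[OF A B]
      by (intro measure_mono_fmeasurable) (auto intro: fmeasurableD)
    then show "0 \<le> ?g s - ?g r" by simp
    have "?g s \<le> measure lebesgue ((A \<union> (B \<inter> ball 0 r)) \<union> (ball 0 s - ball 0 r))"
    proof (rule measure_mono_fmeasurable)
      show "A \<union> (B \<inter> ball 0 r) \<union> (ball 0 s - ball 0 r) \<in> lmeasurable"
        by (intro fmeasurable.Un[OF lmeasurable_Un_Int_ball[OF A B]] fmeasurable_Diff) auto
    qed (use lmeasurable_Un_Int_ball[OF A B] in \<open>auto intro: fmeasurableD\<close>)
    also have "\<dots> \<le> ?g r + measure lebesgue (ball (0::'a) s - ball 0 r)"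
      using lmeasurable_Un_Int_ball[OF A B] by (intro measure_Un_le) (auto intro: fmeasurableD)
    also have "measure lebesgue (ball (0::'a) s - ball 0 r) = h s - h r"
      unfolding h_def using sub by (intro measurable_measure_Diff) auto
    finally show "?g s - ?g r \<le> h s - h r" by simp
  qed
  have "dist (?g s) (?g r) \<le> dist (h s) (h r)" for r s
    using mono[of r s] mono[of s r] by (cases "r \<le> s") (auto simp: dist_real_def)
  then show ?thesis
    using h_cont unfolding continuous_on_iff by (meson le_less_trans)
qed

text \<open>This is atomlessness in the form used below. The sets
  \<open>A \<union> (B \<inter> ball 0 r)\<close> grow from \<open>A\<close> at radius 0 towards
  \<open>B\<close>, and their measure is continuous in \<open>r\<close>, so the intermediate value
  theorem applies.\<close>

lemma lmeasurable_intermediate_measure: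
  fixes A B :: "'a::euclidean_space set"
  assumes A: "A \<in> lmeasurable" and B: "B \<in> lmeasurable" and "A \<subseteq> B"
    and m: "measure lebesgue A \<le> m" "m \<le> measure lebesgue B"
  obtains J where "J \<in> lmeasurable" "A \<subseteq> J" "J \<subseteq> B" "measure lebesgue J = m"
\<comment> \<open>If \<open>B\<close> is unbounded, its full measure may be reached only in the
  limit, so this value is treated separately. Any smaller \<open>m\<close> is exceeded at some
  finite radius.\<close>
proof (cases "m = measure lebesgue B")
  case True
  then show ?thesis using that[of B] assms by auto
next
  case False
  let ?S = "\<lambda>r. A \<union> (B \<inter> ball 0 r)"
  have U: "(\<Union>n. ?S (real n)) = B"
    using \<open>A \<subseteq> B\<close> by (auto intro: reals_Archimedean2)
  have "(\<lambda>n. measure lebesgue (?S (real n))) \<longlonglongrightarrow> measure lebesgue (\<Union>n. ?S (real n))"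
  proof (rule Lim_measure_incseq)
    show "range (\<lambda>n. ?S (real n)) \<subseteq> sets lebesgue"
      using lmeasurable_Un_Int_ball[OF A B] fmeasurableD by blast
    show "incseq (\<lambda>n. ?S (real n))" by (auto simp: incseq_def)
    show "emeasure lebesgue (\<Union>n. ?S (real n)) \<noteq> \<infinity>" unfolding U using fmeasurableD2[OF B] by simp
  qed
  then have "\<forall>\<^sub>F n in sequentially. m < measure lebesgue (?S (real n))"
    using False m(2) unfolding U by (intro order_tendstoD(1)) auto
  then obtain n where n: "m < measure lebesgue (?S (real n))"
    by (auto simp: eventually_sequentially)
  obtain r where "measure lebesgue (?S r) = m"
  proof -
    \<comment> \<open>At the left end \<open>r = 0\<close> the ball is empty and the set is just
      \<open>A\<close>.\<close>
    have "\<exists>r\<ge>0. r \<le> real n \<and> measure lebesgue (?S r) = m"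
      using n m(1)
      by (intro IVT' continuous_on_subset[OF continuous_on_measure_Un_Int_ball[OF A B]]) auto
    then show ?thesis using that by blast
  qed
  then show ?thesis
    using \<open>A \<subseteq> B\<close> lmeasurable_Un_Int_ball[OF A B] by (intro that[of "?S r"]) auto
qed

section \<open>Signs of set integrals\<close>

text \<open>A nonnegative integrand with integral 0 vanishes almost everywhere, which would make
  \<open>A\<close> a null set. This supplies the strict inequalities when \<open>J\<close> lies
  inside \<open>{f < 0}\<close> or contains \<open>{f \<le> 0}\<close>.\<close>

lemma set_integral_pos:
  fixes f :: "'a \<Rightarrow> real"
  assumes int: "set_integrable M A f" and A: "A \<in> sets M" "emeasure M A \<noteq> 0"
    and pos: "\<And>x. x \<in> A \<Longrightarrow> 0 < f x"
  shows "0 < (LINT x:A|M. f x)"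
proof -
  let ?f = "\<lambda>x. indicator A x *\<^sub>R f x"
  have nn: "0 \<le> ?f x" for x using pos[of x] by (auto simp: indicator_def)
  have "\<not> (AE x in M. ?f x = 0)"
  proof
    assume "AE x in M. ?f x = 0"
    then have "AE x in M. x \<notin> A"
      by eventually_elim (use pos in \<open>force simp: indicator_def split: if_splits\<close>)
    then show False using A AE_iff_null_sets[OF A(1)] by auto
  qed
  then have "integral\<^sup>L M ?f \<noteq> 0"
    using integral_nonneg_eq_0_iff_AE[of M ?f] int nn by (auto simp: set_integrable_def)
  moreover have "0 \<le> integral\<^sup>L M ?f" using nn by (intro integral_nonneg_AE) auto
  ultimately show ?thesis by (simp add: set_lebesgue_integral_def)
qed

lemma set_integral_Diff:
  fixes f :: "'a \<Rightarrow> real"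
  assumes "set_integrable M A f" "A \<in> sets M" "B \<in> sets M" "B \<subseteq> A"
  shows "(LINT x:A - B|M. f x) = (LINT x:A|M. f x) - (LINT x:B|M. f x)"
proof -
  have "(LINT x:B \<union> (A - B)|M. f x) = (LINT x:B|M. f x) + (LINT x:A - B|M. f x)"
    using assms by (intro set_integral_Un set_integrable_subset[OF assms(1)]) auto
  moreover have "B \<union> (A - B) = A" using assms by auto
  ultimately show ?thesis by simp
qed

text \<open>Choose \<open>J\<close> comparable under inclusion to both \<open>{f < 0}\<close> and \<open>{f \<le> 0}\<close>.\<close>

lemma exists_measure_eq_set_integral_neg:
  fixes X :: "'a::euclidean_space set" and f :: "'a \<Rightarrow> real"
  assumes X: "X \<in> lmeasurable" and int: "set_integrable lebesgue X f"
    and zero: "(LINT x:X|lebesgue. f x) = 0"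
    and K: "K \<in> sets lebesgue" "K \<subseteq> X" "(LINT x:K|lebesgue. f x) < 0"
    and m: "0 < m" "m < measure lebesgue X"
  obtains J where "J \<in> lmeasurable" "J \<subseteq> X" "measure lebesgue J = m" "(LINT x:J|lebesgue. f x) < 0"
proof -
  note Xs = fmeasurableD[OF X]
  define N where "N = {x \<in> X. f x < 0}"
  define L where "L = {x \<in> X. f x \<le> 0}"
  have [measurable]: "X \<in> sets lebesgue" by (rule Xs)
  have meas [measurable]: "(\<lambda>x. indicator X x *\<^sub>R f x) \<in> borel_measurable lebesgue"
    using int by (simp add: set_integrable_def)
  have "{x \<in> space lebesgue. indicator X x *\<^sub>R f x < 0} \<in> sets lebesgue" by measurable
  also have "{x \<in> space lebesgue. indicator X x *\<^sub>R f x < 0} = N"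
    by (auto simp: N_def indicator_def split: if_splits)
  finally have Ns: "N \<in> sets lebesgue" .
  \<comment> \<open>Off \<open>X\<close> the product is 0 and satisfies the weak inequality, so
    here, unlike for \<open>N\<close>, the intersection with \<open>X\<close> is required.\<close>
  have "{x \<in> space lebesgue. indicator X x *\<^sub>R f x \<le> 0} \<inter> X \<in> sets lebesgue" by measurable
  also have "{x \<in> space lebesgue. indicator X x *\<^sub>R f x \<le> 0} \<inter> X = L"
    by (auto simp: L_def indicator_def split: if_splits)
  finally have Ls: "L \<in> sets lebesgue" .
  have sub: "N \<subseteq> L" "L \<subseteq> X" by (auto simp: N_def L_def)
  have L: "L \<in> lmeasurable" using fmeasurableI2[OF X sub(2) Ls] .
  have N: "N \<in> lmeasurable" using fmeasurableI2[OF L sub(1) Ns] .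
  have intS: "set_integrable lebesgue S f" if "S \<in> sets lebesgue" "S \<subseteq> X" for S
    using set_integrable_subset[OF int that] .
  \<comment> \<open>Collecting exactly the negative values minimizes the integral over measurable
    subsets of \<open>X\<close>, so the negative integral over \<open>K\<close> passes to
    \<open>N\<close>.\<close>
  have "(LINT x:N|lebesgue. f x) \<le> (LINT x:K|lebesgue. f x)"
    unfolding set_lebesgue_integral_def
    using intS[OF Ns] intS[OF K(1,2)] sub K(2)
    by (intro integral_mono) (auto simp: set_integrable_def N_def indicator_def)
  then have Nneg: "(LINT x:N|lebesgue. f x) < 0" using K(3) by simp
  consider "m \<le> measure lebesgue N" | "measure lebesgue N \<le> m" "m \<le> measure lebesgue L"
    | "measure lebesgue L \<le> m" by linarith
  then show ?thesis
  proof cases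
    case 1
    then obtain J where J: "J \<in> lmeasurable" "J \<subseteq> N" "measure lebesgue J = m"
      using lmeasurable_intermediate_measure[of "{}" N m] N m by auto
    \<comment> \<open>\<open>f\<close> is negative throughout \<open>J\<close>, and \<open>J\<close>
      has positive measure \<open>m\<close>.\<close>
    have "0 < (LINT x:J|lebesgue. - f x)"
    proof (rule set_integral_pos)
      show "set_integrable lebesgue J (\<lambda>x. - f x)"
        using intS[of J] J sub by (auto simp: set_integrable_def)
      show "emeasure lebesgue J \<noteq> 0" using J m by (auto simp: measure_def)
    qed (use J in \<open>auto simp: N_def\<close>)
    then show ?thesis using J sub by (intro that[of J]) (auto simp: set_lebesgue_integral_def)
  next
    case 2
    then obtain J where J: "J \<in> lmeasurable" "N \<subseteq> J" "J \<subseteq> L" "measure lebesgue J = m"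
      using lmeasurable_intermediate_measure[OF N L] sub by metis
    \<comment> \<open>\<open>f\<close> vanishes on \<open>J - N\<close>, because \<open>J\<close>
      stays inside \<open>L\<close>.\<close>
    have "(LINT x:J|lebesgue. f x) = (LINT x:N|lebesgue. f x)"
      unfolding set_lebesgue_integral_def
      using J by (intro Bochner_Integration.integral_cong) (auto simp: N_def L_def indicator_def)
    then show ?thesis using J Nneg sub by (intro that[of J]) auto
  next
    case 3
    then obtain J where J: "J \<in> lmeasurable" "L \<subseteq> J" "J \<subseteq> X" "measure lebesgue J = m"
      using lmeasurable_intermediate_measure[OF L X] sub m by (metis less_imp_le)
    \<comment> \<open>The complement of \<open>J\<close> avoids \<open>L\<close>, so
      \<open>f\<close> is positive there, and its measure is positive because
      \<open>m < |X|\<close>. The total integral 0 then makes the integral over \<open>J\<close>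
      negative.\<close>
    have "0 < (LINT x:X - J|lebesgue. f x)"
    proof (rule set_integral_pos)
      have "measure lebesgue (X - J) = measure lebesgue X - m"
        using J X by (subst measurable_measure_Diff) auto
      then show "emeasure lebesgue (X - J) \<noteq> 0" using m by (auto simp: measure_def)
    qed (use J X intS in \<open>auto simp: L_def\<close>)
    then have "(LINT x:J|lebesgue. f x) < 0"
      using set_integral_Diff[OF int Xs fmeasurableD[OF J(1)] J(3)] zero by simp
    then show ?thesis using J by (intro that[of J]) auto
  qed
qed

section \<open>Distances between bounded densities and the uniform distribution\<close>

lemma set_integral_uniform_density:
  assumes U: "uniform_density_on X U" and X: "X \<in> lmeasurable"
    and J: "J \<in> sets lebesgue" "J \<subseteq> X"
  shows "(LINT x:J|lebesgue. U x) = measure lebesgue J / measure lebesgue X"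
proof -
  have int: "set_integrable lebesgue J U"
    using U J by (auto simp: uniform_density_on_def prob_density_on_def intro: set_integrable_subset)
  have "AE x\<in>X in lebesgue. U x = 1 / measure lebesgue X"
    using U by (simp add: uniform_density_on_def)
  then have "AE x in lebesgue. indicator J x *\<^sub>R U x = indicator J x *\<^sub>R (1 / measure lebesgue X)"
    by eventually_elim (use J in \<open>auto simp: indicator_def\<close>)
  then have "(LINT x:J|lebesgue. U x) = (LINT x:J|lebesgue. 1 / measure lebesgue X)"
    unfolding set_lebesgue_integral_def
    using int J by (intro integral_cong_AE) (auto simp: set_integrable_def)
  also have "\<dots> = measure lebesgue J / measure lebesgue X"
    unfolding set_lebesgue_integral_def using J by simp
  finally show ?thesis .
qed

lemma set_integral_bounded_density:
  assumes Z: "Z \<in> bounded_densities X C" and X: "X \<in> lmeasurable"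
    and J: "J \<in> sets lebesgue" "J \<subseteq> X"
  shows "set_integrable lebesgue J Z" "(LINT x:J|lebesgue. Z x) \<le> 1"
    "(LINT x:J|lebesgue. Z x) \<le> C * measure lebesgue J"
proof -
  have int: "set_integrable lebesgue X Z" and nn: "\<And>x. x \<in> X \<Longrightarrow> 0 \<le> Z x"
    and le: "\<And>x. x \<in> X \<Longrightarrow> Z x \<le> C" and one: "(LINT x:X|lebesgue. Z x) = 1"
    using Z by (auto simp: bounded_densities_def prob_density_on_def)
  show intJ: "set_integrable lebesgue J Z" using set_integrable_subset[OF int J] .
  have "(LINT x:J|lebesgue. Z x) \<le> (LINT x:X|lebesgue. Z x)"
    unfolding set_lebesgue_integral_def using int intJ nn J
    by (intro integral_mono) (auto simp: indicator_def set_integrable_def)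
  then show "(LINT x:J|lebesgue. Z x) \<le> 1" using one by simp
  have JL: "J \<in> lmeasurable" using fmeasurableI2[OF X J(2,1)] .
  have "set_integrable lebesgue J (\<lambda>_. C)"
    unfolding set_integrable_def using JL
    by (intro integrable_scaleR_left integrable_real_indicator) (auto simp: fmeasurable_def)
  then have "(LINT x:J|lebesgue. Z x) \<le> (LINT x:J|lebesgue. C)"
    using le J by (intro set_integral_mono intJ) auto
  also have "\<dots> = C * measure lebesgue J"
    unfolding set_lebesgue_integral_def using J by simp
  finally show "(LINT x:J|lebesgue. Z x) \<le> C * measure lebesgue J" .
qed

text \<open>With \<open>j = |J|\<close>, the signed deviation on \<open>J\<close> is at most
  \<open>min 1 (C j) - j / V\<close>. This increases up to \<open>j = 1 / C\<close> and decreases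
  afterwards, and its peak is \<open>1 - 1 / (C V)\<close>.\<close>

lemma variation_divergence_uniform_le:
  assumes X: "X \<in> lmeasurable" "0 < measure lebesgue X" and C: "1 / measure lebesgue X < C"
    and U: "uniform_density_on X U" and Z: "Z \<in> bounded_densities X C"
  shows "variation_divergence X Z U \<le> 2 * (1 - 1 / (C * measure lebesgue X))"
proof -
  let ?V = "measure lebesgue X"
  have Cpos: "0 < C" using X C by (meson less_trans zero_less_divide_1_iff)
  have CV: "1 < C * ?V" using C X(2) by (simp add: field_simps)
  have intX: "set_integrable lebesgue X Z" "set_integrable lebesgue X U"
    and one: "(LINT x:X|lebesgue. Z x) = 1" "(LINT x:X|lebesgue. U x) = 1"
    using Z U by (auto simp: bounded_densities_def uniform_density_on_def prob_density_on_def)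
  have intd: "set_integrable lebesgue X (\<lambda>x. Z x - U x)" using intX by (rule set_integral_diff)
  have upper: "(LINT x:J|lebesgue. Z x - U x) \<le> 1 - 1 / (C * ?V)"
    if J: "J \<in> sets lebesgue" "J \<subseteq> X" for J
  proof -
    let ?j = "measure lebesgue J"
    note ZJ = set_integral_bounded_density[OF Z X(1) J]
    have eq: "(LINT x:J|lebesgue. Z x - U x) = (LINT x:J|lebesgue. Z x) - ?j / ?V"
      using set_integral_diff(2)[OF ZJ(1) set_integrable_subset[OF intX(2) J]]
        set_integral_uniform_density[OF U X(1) J] by simp
    show ?thesis
    proof (cases "1 \<le> C * ?j")
      case True
      then have "1 / (C * ?V) \<le> ?j / ?V" using Cpos X(2) by (simp add: field_simps)
      then show ?thesis using eq ZJ(2) by linarith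
    next
      case False
      \<comment> \<open>Factoring out \<open>C * ?j < 1\<close> leaves a factor that is nonnegative
        because \<open>C * ?V > 1\<close>.\<close>
      have "C * ?j - ?j / ?V = (C * ?j) * (1 - 1 / (C * ?V))"
        using Cpos X(2) by (simp add: field_simps)
      also have "\<dots> \<le> 1 * (1 - 1 / (C * ?V))"
        using False CV by (intro mult_right_mono) auto
      finally have "C * ?j - ?j / ?V \<le> 1 - 1 / (C * ?V)" by simp
      moreover have "(LINT x:J|lebesgue. Z x - U x) \<le> C * ?j - ?j / ?V" using eq ZJ(3) by simp
      ultimately show ?thesis by (rule order_trans[rotated])
    qed
  qed
  have "\<bar>LINT x:J|lebesgue. Z x - U x\<bar> \<le> 1 - 1 / (C * ?V)"
    if J: "J \<in> sets lebesgue" "J \<subseteq> X" for J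
  proof -
    \<comment> \<open>Both densities have mass 1, so \<open>upper\<close> applied to the complement
      is the lower bound on \<open>J\<close>.\<close>
    have "(LINT x:X - J|lebesgue. Z x - U x) = - (LINT x:J|lebesgue. Z x - U x)"
      using set_integral_Diff[OF intd fmeasurableD[OF X(1)] J] set_integral_diff(2)[OF intX] one
      by simp
    then show ?thesis using upper[OF J] upper[of "X - J"] J X(1) by (auto simp: abs_le_iff)
  qed
  then have "(SUP J\<in>{J \<in> sets lebesgue. J \<subseteq> X}. \<bar>LINT x:J|lebesgue. (Z x - U x)\<bar>)
      \<le> 1 - 1 / (C * ?V)"
    by (intro cSUP_least) auto
  then show ?thesis by (simp add: variation_divergence_def)
qed

text \<open>The witness for the strict inequality: all mass sits on \<open>J\<close> at the maximal
  height \<open>C\<close>, and the measure \<open>1 / C\<close> is what normalizes it.\<close>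

lemma indicator_bounded_density:
  assumes J: "J \<in> lmeasurable" "J \<subseteq> X" and X: "X \<in> lmeasurable"
    and C: "0 < C" "measure lebesgue J = 1 / C"
  shows "(\<lambda>x. C * indicator J x) \<in> bounded_densities X C" "(LINT x:J|lebesgue. C * indicator J x) = 1"
proof -
  have eq: "indicator X x *\<^sub>R (C * indicator J x) = C * indicator J x" for x :: 'a
    using J by (auto simp: indicator_def)
  have eqJ: "indicator J x *\<^sub>R (C * indicator J x) = C * indicator J x" for x :: 'a
    by (auto simp: indicator_def)
  have int: "integrable lebesgue (\<lambda>x. C * indicator J x)"
    using J by (intro integrable_mult_right integrable_real_indicator) (auto simp: fmeasurable_def)
  have one: "(LINT x|lebesgue. C * indicator J x) = 1" using C J by simp
  show "(LINT x:J|lebesgue. C * indicator J x) = 1"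
    using one by (simp only: set_lebesgue_integral_def eqJ)
  have "set_integrable lebesgue X (\<lambda>x. C * indicator J x)"
    using int by (simp only: set_integrable_def eq)
  moreover have "(LINT x:X|lebesgue. C * indicator J x) = 1"
    using one by (simp only: set_lebesgue_integral_def eq)
  ultimately show "(\<lambda>x. C * indicator J x) \<in> bounded_densities X C"
    using C by (auto simp: bounded_densities_def prob_density_on_def indicator_def)
qed

theorem theorem3p2:
  fixes X :: "'a::euclidean_space set" and C :: real and PS PU PS' :: "'a \<Rightarrow> real"
  assumes "X \<in> lmeasurable" and "measure lebesgue X > 0"
    and "C > 1 / measure lebesgue X"
    and "prob_density_on X PS"
    and "uniform_density_on X PU"
    and "PS' \<in> nonuniform_reweightings X PS"
  shows "(SUP Z\<in>bounded_densities X C. variation_divergence X Z PS')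
       > (SUP Z\<in>bounded_densities X C. variation_divergence X Z PU)"
proof -
  note X = assms(1,2)
  let ?V = "measure lebesgue X"
  have Cpos: "0 < C" using assms(2,3) by (meson less_trans zero_less_divide_1_iff)
  have U: "prob_density_on X PU" using assms(5) by (simp add: uniform_density_on_def)
  obtain K where Q: "prob_density_on X PS'" and K: "K \<in> sets lebesgue" "K \<subseteq> X"
    "(LINT x:K|lebesgue. PS' x) < measure lebesgue K / ?V"
    using assms(6) by (auto simp: nonuniform_reweightings_def)
  have intQ: "set_integrable lebesgue X PS'" and intU: "set_integrable lebesgue X PU"
    and one: "(LINT x:X|lebesgue. PS' x) = 1" "(LINT x:X|lebesgue. PU x) = 1"
    using Q U by (auto simp: prob_density_on_def)
  \<comment> \<open>Non-uniformity says that \<open>f\<close> has a negative integral over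
    \<open>K\<close>, while equal total masses make its integral over \<open>X\<close> zero.\<close>
  define f where "f x = PS' x - PU x" for x
  have intf: "set_integrable lebesgue X f"
    unfolding f_def using intQ intU by (rule set_integral_diff)
  have f_eq: "(LINT x:J|lebesgue. f x) = (LINT x:J|lebesgue. PS' x) - measure lebesgue J / ?V"
    if J: "J \<in> sets lebesgue" "J \<subseteq> X" for J
    unfolding f_def
    using set_integral_diff(2)[OF set_integrable_subset[OF intQ J] set_integrable_subset[OF intU J]]
      set_integral_uniform_density[OF assms(5) X(1) J] by simp
  \<comment> \<open>The measure \<open>1 / C\<close> is where the bound for the uniform distribution
    peaks; \<open>C > 1 / |X|\<close> places it strictly below \<open>|X|\<close>.\<close>
  obtain J where J: "J \<in> lmeasurable" "J \<subseteq> X" "measure lebesgue J = 1 / C"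
    "(LINT x:J|lebesgue. f x) < 0"
  proof (rule exists_measure_eq_set_integral_neg[OF X(1) intf _ K(1,2), of "1 / C"])
    show "(LINT x:X|lebesgue. f x) = 0" using f_eq[of X] X one by (auto simp: fmeasurableD)
    show "(LINT x:K|lebesgue. f x) < 0" using f_eq[OF K(1,2)] K(3) by simp
    show "1 / C < ?V" using assms(2,3) Cpos by (simp add: field_simps)
  qed (use Cpos in auto)
  note Js = fmeasurableD[OF J(1)]
  let ?Z = "\<lambda>x. C * indicator J x"
  note Z = indicator_bounded_density[OF J(1,2) X(1) Cpos J(3)]
  have Zp: "prob_density_on X ?Z" using Z(1) by (simp add: bounded_densities_def)
  \<comment> \<open>Testing the divergence on the support \<open>J\<close> of \<open>?Z\<close>
    already gives a strict lower bound.\<close>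
  have "(LINT x:J|lebesgue. ?Z x - PS' x) = 1 - (LINT x:J|lebesgue. PS' x)"
    using set_integral_diff(2)[OF set_integral_bounded_density(1)[OF Z(1) X(1) Js J(2)]
        set_integrable_subset[OF intQ Js J(2)]] Z(2) by simp
  moreover have "(LINT x:J|lebesgue. PS' x) < 1 / (C * ?V)"
    using J(4) f_eq[OF Js J(2)] J(3) by simp
  moreover have "\<bar>LINT x:J|lebesgue. ?Z x - PS' x\<bar>
      \<le> (SUP J\<in>{J \<in> sets lebesgue. J \<subseteq> X}. \<bar>LINT x:J|lebesgue. (?Z x - PS' x)\<bar>)"
    using Js J(2) by (intro cSUP_upper bdd_above_variation_divergence[OF Zp Q]) auto
  ultimately have "1 - 1 / (C * ?V)
      < (SUP J\<in>{J \<in> sets lebesgue. J \<subseteq> X}. \<bar>LINT x:J|lebesgue. (?Z x - PS' x)\<bar>)"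
    by linarith
  then have lower: "2 * (1 - 1 / (C * ?V)) < variation_divergence X ?Z PS'"
    unfolding variation_divergence_def by (rule mult_strict_left_mono) simp
  \<comment> \<open>\<open>Z(1)\<close> shows that the family is nonempty, as
    \<open>cSUP_least\<close> requires. Strictness survives the suprema because \<open>lower\<close>
    holds for the single density \<open>?Z\<close>.\<close>
  have "(SUP Z\<in>bounded_densities X C. variation_divergence X Z PU) \<le> 2 * (1 - 1 / (C * ?V))"
    using Z(1) variation_divergence_uniform_le[OF X assms(3,5)] by (intro cSUP_least) auto
  also note lower
  also have "variation_divergence X ?Z PS'
      \<le> (SUP Z\<in>bounded_densities X C. variation_divergence X Z PS')"
    using Z(1) by (intro cSUP_upper bdd_above_variation_divergence_family[OF Q])
  finally show ?thesis .
qed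

end
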